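(* Let $k\in\mathbb{N}=\{1,2,\ldots\}$ and $j\in\mathbb{Z}_+$, and assume $1+h_j-d_{j,k}>0$. Let $\hat h_{j,k}=V_j^k/N_j^k$. Then: a) $$\mathbb{E}(\hat h_{j,k})=\frac{(d_{j,k}-h_j)h_j}{(1+h_j-d_{j,k})^2}\log(d_{j,k}-h_j)+\frac{h_j}{1+h_j-d_{j,k}}.$$ b) $$\mathrm{Var}(\hat h_{j,k})=\frac{(d_{j,k}-h_j)(h_j+d_{j,k}-1)h_j}{(1+h_j-d_{j,k})^3}\mathrm{Li}_2(1+h_j-d_{j,k})-\frac{(d_{j,k}-h_j)^2h_j^2}{(1+h_j-d_{j,k})^4}\big(\log(d_{j,k}-h_j)\big)^2-\frac{(d_{j,k}-h_j)(1-d_{j,k})h_j}{(1+h_j-d_{j,k})^3}\log(d_{j,k}-h_j).$$ Consequently, the mean squared error $\mathrm{MSE}(\hat h_{j,k})=\mathbb{E}\big((\hat h_{j,k}-h_j)^2\big)$ is $$\mathrm{MSE}(\hat h_{j,k})=\frac{(d_{j,k}-h_j)(h_j+d_{j,k}-1)h_j}{(1+h_j-d_{j,k})^3}\mathrm{Li}_2(1+h_j-d_{j,k})+\frac{h_j^2(d_{j,k}-h_j)^2}{(1+h_j-d_{j,k})^2}+\frac{(d_{j,k}-h_j)\big(2h_j(d_{j,k}-h_j)-(1-d_{j,k})\big)h_j}{(1+h_j-d_{j,k})^3}\log(d_{j,k}-h_j).$$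
   Context: $\mathbb{Z}_+=\{0,1,2,\ldots\}$. $X_1,X_2,\ldots$ are i.i.d. random variables with values in $\mathbb{Z}_+$ and infinite support; $P(i)=\mathbb{P}(X_1=i)$, $\overline F(i)=\mathbb{P}(X_1>i)$; $h_j=P(j)/\overline F(j-1)$ is the hazard rate; for $\ell\ge j$, $h_{\ell\vert j}=P(\ell)/\overline F(j-1)$ and $\overline F(\ell\vert j)=\overline F(\ell)/\overline F(j-1)$. Put $d_{j,k}=1-\sum_{i=1}^k h_{j+i\vert j}=h_j+\overline F(j+k\vert j)$. $\mathrm{Li}_2(x)=\sum_{n\ge1}x^n/n^2$ for $x\in[-1,1]$ is the dilogarithm. Let $M_i=\max\{X_1,\ldots,X_i\}$. For $m\in\mathbb{Z}_+$ and $\ell=0,\ldots,k$ define, from the entire sequence, $A_m^0=\mathbf 1_{\{X_1=m\}}+\sum_{i=2}^\infty\mathbf 1_{\{X_i=m,\,M_{i-1}\le m\}}$; $A_m^\ell=\sum_{i=2}^\infty\mathbf 1_{\{X_i=m,\,M_{i-1}=m+\ell\}}$ for $\ell\ge1$; $V_m^\ell=\sum_{i=0}^\ell A_m^i$; $N_m^\ell=1+\sum_{i=0}^\ell V_{m+i}^{\ell-i}$. The estimator is $\hat h_{j,k}=V_j^k/N_j^k$. (It coincides with the estimator computed from the first $n$ records $R_1<\dots<R_n$ of the sequence and the observations $X_i$ with $M_{i-1}-k\le X_i\le M_{i-1}$ made before the $(n+1)$-th record, whenever $R_n\ge j+k$.) *)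

theory Defs
  imports "HOL-Probability.Probability"
begin

text \<open>
  Throughout, the observations are \<open>X 1, X 2, \<dots>\<close>, so the sequence is indexed from \<open>1\<close>
  and \<open>X 0\<close> is never used.
\<close>

definition prob_at :: "'a measure \<Rightarrow> (nat \<Rightarrow> 'a \<Rightarrow> nat) \<Rightarrow> nat \<Rightarrow> real" where
  "prob_at M X i = measure M {\<omega> \<in> space M. X 1 \<omega> = i}"

text \<open>The argument is an integer so that the survival function can be evaluated at \<open>-1\<close>.\<close>

definition survival :: "'a measure \<Rightarrow> (nat \<Rightarrow> 'a \<Rightarrow> nat) \<Rightarrow> int \<Rightarrow> real" where
  "survival M X i = measure M {\<omega> \<in> space M. int (X 1 \<omega>) > i}"

definition hazard :: "'a measure \<Rightarrow> (nat \<Rightarrow> 'a \<Rightarrow> nat) \<Rightarrow> nat \<Rightarrow> real" where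
  "hazard M X j = prob_at M X j / survival M X (int j - 1)"

text \<open>\<open>cond_hazard M X l j\<close> is $h_{l \vert j}$, meant for \<open>j \<le> l\<close>.\<close>

definition cond_hazard :: "'a measure \<Rightarrow> (nat \<Rightarrow> 'a \<Rightarrow> nat) \<Rightarrow> nat \<Rightarrow> nat \<Rightarrow> real" where
  "cond_hazard M X l j = prob_at M X l / survival M X (int j - 1)"

definition d_coeff :: "'a measure \<Rightarrow> (nat \<Rightarrow> 'a \<Rightarrow> nat) \<Rightarrow> nat \<Rightarrow> nat \<Rightarrow> real" where
  "d_coeff M X j k = 1 - (\<Sum>i=1..k. cond_hazard M X (j + i) j)"

text \<open>Only meaningful for \<open>i \<ge> 1\<close>.\<close>

definition running_max :: "(nat \<Rightarrow> 'a \<Rightarrow> nat) \<Rightarrow> nat \<Rightarrow> 'a \<Rightarrow> nat" where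
  "running_max X i \<omega> = Max ((\<lambda>n. X n \<omega>) ` {1..i})"

text \<open>
  \<open>count_A X m l\<close> is $A_m^l$. For an i.i.d. sequence whose law has infinite support, the series
  below have almost surely only finitely many nonzero terms; on the exceptional null set the
  value of \<open>suminf\<close> is irrelevant.
\<close>

definition count_A :: "(nat \<Rightarrow> 'a \<Rightarrow> nat) \<Rightarrow> nat \<Rightarrow> nat \<Rightarrow> 'a \<Rightarrow> real" where
  "count_A X m l \<omega> =
     (if l = 0
      then of_bool (X 1 \<omega> = m)
           + (\<Sum>i. of_bool (i \<ge> 2 \<and> X i \<omega> = m \<and> running_max X (i - 1) \<omega> \<le> m))
      else (\<Sum>i. of_bool (i \<ge> 2 \<and> X i \<omega> = m \<and> running_max X (i - 1) \<omega> = m + l)))"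

definition count_V :: "(nat \<Rightarrow> 'a \<Rightarrow> nat) \<Rightarrow> nat \<Rightarrow> nat \<Rightarrow> 'a \<Rightarrow> real" where
  "count_V X m l \<omega> = (\<Sum>i=0..l. count_A X m i \<omega>)"

definition count_N :: "(nat \<Rightarrow> 'a \<Rightarrow> nat) \<Rightarrow> nat \<Rightarrow> nat \<Rightarrow> 'a \<Rightarrow> real" where
  "count_N X m l \<omega> = 1 + (\<Sum>i=0..l. count_V X (m + i) (l - i) \<omega>)"

definition hazard_est :: "(nat \<Rightarrow> 'a \<Rightarrow> nat) \<Rightarrow> nat \<Rightarrow> nat \<Rightarrow> 'a \<Rightarrow> real" where
  "hazard_est X j k \<omega> = count_V X j k \<omega> / count_N X j k \<omega>"

text \<open>The dilogarithm on $[-1,1]$; the series does not converge elsewhere.\<close>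

definition Li2 :: "real \<Rightarrow> real" where
  "Li2 x = (\<Sum>n. x ^ Suc n / (real (Suc n))\<^sup>2)"

end

theory Submission
  imports Defs
begin

text \<open>
  Let \<open>T\<close> be the first index with \<open>X T > j + k\<close>. Only the observations before \<open>T\<close> contribute to the
  counts: \<open>V\<close> is the number of them equal to \<open>j\<close>, and \<open>N - 1\<close> the number of them that are at
  least \<open>j\<close>. Discarding the observations below \<open>j\<close> shows that \<open>N\<close> is geometric with success
  probability \<open>d - h\<close> and that \<open>V\<close> given \<open>N = n + 1\<close> is binomial with parameters \<open>n\<close> and
  \<open>h / (1 + h - d)\<close>. The moments of \<open>V / N\<close> are then combinations of the series of
  \<open>r ^ n\<close>, \<open>r ^ n / n\<close> and \<open>r ^ n / n\<^sup>2\<close> at \<open>r = 1 + h - d\<close>. Instead of the joint law, only the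
  moments of order at most two of \<open>V\<close> on \<open>N = n + 1\<close> are computed, by a recursion in \<open>n\<close>
  that splits off the last of the observations before \<open>T\<close>.
\<close>

subsection \<open>The counts at the first exceedance\<close>

lemma running_max_le_iff:
  assumes "i \<ge> 1"
  shows "running_max X i \<omega> \<le> m \<longleftrightarrow> (\<forall>n\<in>{1..i}. X n \<omega> \<le> m)"
  using assms by (auto simp: running_max_def Max_le_iff)

lemma running_max_ge: "n \<in> {1..i} \<Longrightarrow> X n \<omega> \<le> running_max X i \<omega>"
  by (simp add: running_max_def)

text \<open>
  Each \<open>i\<close> with \<open>X i \<omega> = m\<close> is counted for exactly one \<open>l\<close>; the truncated subtraction gives \<open>l = 0\<close>
  when the running maximum is at most \<open>m\<close>.
\<close>

lemma count_A_until:
  assumes "\<forall>i\<in>{1..t}. X i \<omega> \<le> b" "X (Suc t) \<omega> > b" "m + l \<le> b"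
  shows "count_A X m l \<omega> =
    (\<Sum>i\<in>{1..t}. of_bool (X i \<omega> = m \<and>
       l = (if i = 1 then 0 else running_max X (i - 1) \<omega> - m)))"
proof -
  \<comment> \<open>Observation \<open>Suc t\<close> exceeds \<open>b\<close> and hence is not
    \<open>m\<close>; from then on the running maximum includes it and stays above
    \<open>m + l\<close>. So the infinite series reduces to a sum over
    \<open>{1..t}\<close>.\<close>
  have late: "X i \<omega> \<noteq> m \<or> running_max X (i - 1) \<omega> > m + l" if "i \<notin> {1..t}" "i \<ge> 1" for i
  proof (cases "i = Suc t")
    case False
    with that have "Suc t \<in> {1..i - 1}" by auto
    from running_max_ge[of _ _ X \<omega>, OF this] assms show ?thesis by linarith
  qed (use assms in auto)
  have *: "(\<Sum>i. of_bool (i \<ge> 2 \<and> P i)) = (\<Sum>i\<in>{1..t}. of_bool (i \<ge> 2 \<and> P i) :: real)"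
    if "\<And>i. i \<notin> {1..t} \<Longrightarrow> i \<ge> 2 \<Longrightarrow> \<not> P i" for P
    by (rule suminf_finite) (use that in auto)
  show ?thesis
  proof (cases "l = 0")
    case True
    \<comment> \<open>The isolated first term becomes a sum over \<open>{1..t}\<close>; for
      \<open>t = 0\<close> both sides vanish, as then
      \<open>X 1 \<omega> > b \<ge> m\<close>.\<close>
    have 1: "of_bool (X 1 \<omega> = m) = (\<Sum>i\<in>{1..t}. of_bool (i = 1 \<and> X 1 \<omega> = m) :: real)"
    proof (cases "t = 0")
      case False
      then have "(\<Sum>i\<in>{1..t}. of_bool (i = 1 \<and> X 1 \<omega> = m) :: real)
        = (\<Sum>i\<in>{1::nat}. of_bool (i = 1 \<and> X 1 \<omega> = m))"
        by (intro sum.mono_neutral_right) auto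
      then show ?thesis by simp
    qed (use assms in auto)
    have "count_A X m l \<omega> = (\<Sum>i\<in>{1..t}. of_bool (i = 1 \<and> X 1 \<omega> = m))
      + (\<Sum>i\<in>{1..t}. of_bool (i \<ge> 2 \<and> X i \<omega> = m \<and> running_max X (i - 1) \<omega> \<le> m))"
      unfolding count_A_def using True 1 late
      by (subst *[of "\<lambda>i. X i \<omega> = m \<and> running_max X (i - 1) \<omega> \<le> m"]) fastforce+
    also have "\<dots> = (\<Sum>i\<in>{1..t}. of_bool (i = 1 \<and> X 1 \<omega> = m)
      + of_bool (i \<ge> 2 \<and> X i \<omega> = m \<and> running_max X (i - 1) \<omega> \<le> m))"
      by (simp add: sum.distrib)
    also have "\<dots> = (\<Sum>i\<in>{1..t}. of_bool (X i \<omega> = m \<and>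
       l = (if i = 1 then 0 else running_max X (i - 1) \<omega> - m)))"
      using True by (intro sum.cong) auto
    finally show ?thesis .
  next
    case False
    have "count_A X m l \<omega>
      = (\<Sum>i\<in>{1..t}. of_bool (i \<ge> 2 \<and> X i \<omega> = m \<and> running_max X (i - 1) \<omega> = m + l))"
      unfolding count_A_def using False late
      by (subst *[of "\<lambda>i. X i \<omega> = m \<and> running_max X (i - 1) \<omega> = m + l"]) fastforce+
    also have "\<dots> = (\<Sum>i\<in>{1..t}. of_bool (X i \<omega> = m \<and>
       l = (if i = 1 then 0 else running_max X (i - 1) \<omega> - m)))"
      using False by (intro sum.cong) auto
    finally show ?thesis .
  qed
qed

text \<open>Before the exceedance the running maximum is at most \<open>m + l\<close>, so the excess
  over \<open>m\<close> takes a value in \<open>{0..l}\<close> and each visit to \<open>m\<close> is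
  counted by exactly one summand.\<close>

lemma count_V_until:
  assumes "\<forall>i\<in>{1..t}. X i \<omega> \<le> m + l" "X (Suc t) \<omega> > m + l"
  shows "count_V X m l \<omega> = real (card {i\<in>{1..t}. X i \<omega> = m})"
proof -
  \<comment> \<open>At \<open>i = 1\<close> the preceding maximum would range over the empty set,
    hence the separate value \<open>0\<close>.\<close>
  let ?R = "\<lambda>i. if i = 1 then 0 else running_max X (i - 1) \<omega> - m"
  have le: "?R i \<le> l" if "i \<in> {1..t}" for i
  proof (cases "i = 1")
    case False
    with that have "running_max X (i - 1) \<omega> \<le> m + l"
      using assms by (subst running_max_le_iff) auto
    then show ?thesis using False by simp
  qed simp
  have "count_V X m l \<omega> = (\<Sum>e=0..l. \<Sum>i\<in>{1..t}. of_bool (X i \<omega> = m \<and> e = ?R i))"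
    unfolding count_V_def using assms by (intro sum.cong count_A_until) auto
  also have "\<dots> = (\<Sum>i\<in>{1..t}. \<Sum>e=0..l. of_bool (X i \<omega> = m \<and> e = ?R i))"
    by (rule sum.swap)
  also have "\<dots> = (\<Sum>i\<in>{1..t}. of_bool (X i \<omega> = m))"
  proof (intro sum.cong refl)
    fix i assume i: "i \<in> {1..t}"
    have "(\<Sum>e=0..l. of_bool (X i \<omega> = m \<and> e = ?R i) :: real)
      = (\<Sum>e=0..l. if e = ?R i then of_bool (X i \<omega> = m) else 0)"
      by (intro sum.cong) auto
    also have "\<dots> = of_bool (X i \<omega> = m)"
      using le[OF i] by (subst sum.delta) auto
    finally show "(\<Sum>e=0..l. of_bool (X i \<omega> = m \<and> e = ?R i) :: real) = of_bool (X i \<omega> = m)" .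
  qed
  also have "\<dots> = real (card {i\<in>{1..t}. X i \<omega> = m})"
  proof -
    have "{1..t} \<inter> {i. X i \<omega> = m} = {i\<in>{1..t}. X i \<omega> = m}" by auto
    then show ?thesis by (simp add: of_bool_def sum.If_cases)
  qed
  finally show ?thesis .
qed

text \<open>Level \<open>j + i\<close> is paired with depth \<open>k - i\<close>, so all summands
  share the threshold \<open>j + k\<close> and therefore the same \<open>t\<close>.\<close>

lemma count_N_until:
  assumes "\<forall>i\<in>{1..t}. X i \<omega> \<le> j + k" "X (Suc t) \<omega> > j + k"
  shows "count_N X j k \<omega> = real (Suc (card {i\<in>{1..t}. j \<le> X i \<omega>}))"
proof -
  have "count_N X j k \<omega> = 1 + (\<Sum>i=0..k. real (card {n\<in>{1..t}. X n \<omega> = j + i}))"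
    unfolding count_N_def using assms by (intro arg_cong2[of _ _ _ _ "(+)"] sum.cong count_V_until) auto
  also have "(\<Sum>i=0..k. real (card {n\<in>{1..t}. X n \<omega> = j + i}))
    = real (card (\<Union>i\<in>{0..k}. {n\<in>{1..t}. X n \<omega> = j + i}))"
    by (subst card_UN_disjoint) auto
  also have "(\<Union>i\<in>{0..k}. {n\<in>{1..t}. X n \<omega> = j + i}) = {i\<in>{1..t}. j \<le> X i \<omega>}"
  proof -
    have "\<exists>i\<in>{0..k}. X n \<omega> = j + i" if "n \<in> {1..t}" "j \<le> X n \<omega>" for n
      using that assms by (intro bexI[of _ "X n \<omega> - j"]) fastforce+
    then show ?thesis by auto
  qed
  finally show ?thesis by simp
qed

subsection \<open>Series\<close>

lemma sums_ln_one_minus: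
  fixes x :: real
  assumes "0 < x" "x < 1"
  shows "(\<lambda>n. x ^ Suc n / real (Suc n)) sums (- ln (1 - x))"
proof -
  have sm: "summable (\<lambda>n. x ^ n / real n)"
    using norm_summable_ln_series[of x] assms by (auto intro: summable_norm_cancel)
  have "ln (1 - x) = (\<Sum>n. (-1)^n * (1 / real (n + 1)) * ((1 - x) - 1)^(Suc n))"
    using assms by (intro ln_series) auto
  also have "(\<lambda>n. (-1)^n * (1 / real (n + 1)) * ((1 - x) - 1)^(Suc n))
    = (\<lambda>n. - (x ^ Suc n / real (Suc n)))"
  proof
    fix n
    have "((1 - x) - 1) ^ Suc n = (-1) ^ Suc n * x ^ Suc n"
      using power_minus[of x "Suc n"] by simp
    then show "(-1)^n * (1 / real (n + 1)) * ((1 - x) - 1)^(Suc n) = - (x ^ Suc n / real (Suc n))"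
      by (simp add: mult_ac flip: power_mult_distrib)
  qed
  finally have "ln (1 - x) = - (\<Sum>n. x ^ Suc n / real (Suc n))"
    using summable_ignore_initial_segment[OF sm, of 1] by (simp add: suminf_minus)
  then show ?thesis
    using summable_ignore_initial_segment[OF sm, of 1] by (simp add: sums_iff)
qed

text \<open>Only summability is at stake, and it follows by comparison with the logarithmic
  series.\<close>

lemma sums_Li2:
  assumes "0 < x" "x < 1"
  shows "(\<lambda>n. x ^ Suc n / (real (Suc n))\<^sup>2) sums Li2 x"
  unfolding Li2_def
proof (rule summable_sums, rule summable_comparison_test'[of _ 0])
  show "summable (\<lambda>n. x ^ Suc n / real (Suc n))"
    using sums_ln_one_minus[OF assms] by (rule sums_summable)
  show "norm (x ^ Suc n / (real (Suc n))\<^sup>2) \<le> x ^ Suc n / real (Suc n)" for n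
  proof -
    have "x ^ Suc n / (real (Suc n))\<^sup>2 \<le> x ^ Suc n / real (Suc n)"
      using assms by (intro divide_left_mono) (simp_all add: power2_eq_square)
    then show ?thesis using assms by simp
  qed
qed

text \<open>The summand is the geometric weight \<open>(1 - r) * r ^ n\<close> times the binomial
  mean \<open>n * h / r\<close>, divided by \<open>n + 1\<close>. Writing \<open>n / (n + 1)\<close>
  as \<open>1 - 1 / (n + 1)\<close> leaves a geometric and a logarithmic series.\<close>

lemma sums_first_moment:
  fixes r h :: real
  assumes r: "0 < r" "r < 1"
  shows "(\<lambda>n. (1 - r) * (r ^ n * (1 / real (Suc n) * real n * h * r)) / r\<^sup>2)
    sums ((1 - r) * h / r\<^sup>2 * ln (1 - r) + h / r)"
proof -
  have "(\<lambda>n. (1 - r) * h / r * (r ^ n - r ^ Suc n / real (Suc n) / r))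
    sums ((1 - r) * h / r * (1 / (1 - r) - - ln (1 - r) / r))"
    using r by (intro sums_mult sums_diff sums_divide sums_ln_one_minus geometric_sums) auto
  moreover have "(1 - r) * h / r * (r ^ n - r ^ Suc n / real (Suc n) / r)
    = (1 - r) * (r ^ n * (1 / real (Suc n) * real n * h * r)) / r\<^sup>2" for n
  proof -
    \<comment> \<open>Here \<open>p\<close> stands for \<open>r ^ n\<close> and \<open>x\<close> for
      \<open>n + 1\<close>, which keeps the identity rational.\<close>
    have "(1 - r) * h / r * (p - r * p / x / r) = (1 - r) * (p * (1 / x * (x - 1) * h * r)) / r\<^sup>2"
      if "x \<noteq> 0" for p x :: real
      using r that by (simp add: field_simps power2_eq_square)
    from this[of "real (Suc n)" "r ^ n"] show ?thesis by simp
  qed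
  moreover have "(1 - r) * h / r * (1 / (1 - r) - - ln (1 - r) / r)
    = (1 - r) * h / r\<^sup>2 * ln (1 - r) + h / r"
    using r by (simp add: power2_eq_square distrib_left add.commute)
  ultimately show ?thesis by simp
qed

text \<open>Now the binomial second moment is weighted. In powers of \<open>x = n + 1\<close> the
  factor is \<open>h\<^sup>2 + (h * r - 3 * h\<^sup>2) / x + (2 * h\<^sup>2 - h * r) /
  x\<^sup>2\<close>; the last term produces the dilogarithm.\<close>

lemma sums_second_moment:
  fixes r h :: real
  assumes r: "0 < r" "r < 1"
  shows "(\<lambda>n. (1 - r) * (r ^ n * (1 / (real (Suc n))\<^sup>2 *
      (real n * h * r + real n * (real n - 1) * h\<^sup>2))) / r\<^sup>2)
    sums (h\<^sup>2 / r\<^sup>2 - (1 - r) * (h * r - 3 * h\<^sup>2) / r ^ 3 * ln (1 - r)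
      + (1 - r) * (2 * h\<^sup>2 - h * r) / r ^ 3 * Li2 r)"
proof -
  let ?L = "\<lambda>n. r ^ Suc n / real (Suc n)" and ?D = "\<lambda>n. r ^ Suc n / (real (Suc n))\<^sup>2"
  have "(\<lambda>n. (1 - r) / r\<^sup>2 * (h\<^sup>2 * r ^ n + (h * r - 3 * h\<^sup>2) / r * ?L n + (2 * h\<^sup>2 - h * r) / r * ?D n))
    sums ((1 - r) / r\<^sup>2 * (h\<^sup>2 * (1 / (1 - r)) + (h * r - 3 * h\<^sup>2) / r * (- ln (1 - r))
      + (2 * h\<^sup>2 - h * r) / r * Li2 r))"
    using r by (intro sums_mult sums_add sums_ln_one_minus sums_Li2 geometric_sums) auto
  moreover have "(1 - r) / r\<^sup>2 * (h\<^sup>2 * r ^ n + (h * r - 3 * h\<^sup>2) / r * ?L n + (2 * h\<^sup>2 - h * r) / r * ?D n)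
    = (1 - r) * (r ^ n * (1 / (real (Suc n))\<^sup>2 *
      (real n * h * r + real n * (real n - 1) * h\<^sup>2))) / r\<^sup>2" for n
  proof -
    have "(1 - r) / r\<^sup>2 * (h\<^sup>2 * p + (h * r - 3 * h\<^sup>2) / r * (r * p / x) + (2 * h\<^sup>2 - h * r) / r * (r * p / x\<^sup>2))
      = (1 - r) * (p * (1 / x\<^sup>2 * ((x - 1) * h * r + (x - 1) * (x - 1 - 1) * h\<^sup>2))) / r\<^sup>2"
      if "x \<noteq> 0" for p x :: real
    proof -
      have "h\<^sup>2 * p + (h * r - 3 * h\<^sup>2) / r * (r * p / x) + (2 * h\<^sup>2 - h * r) / r * (r * p / x\<^sup>2)
        = p * (1 / x\<^sup>2 * ((x - 1) * h * r + (x - 1) * (x - 1 - 1) * h\<^sup>2))"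
        using r that by (simp add: field_simps power2_eq_square)
      then show ?thesis by simp
    qed
    from this[of "real (Suc n)" "r ^ n"] show ?thesis by simp
  qed
  moreover have "(1 - r) / r\<^sup>2 * (h\<^sup>2 * (1 / (1 - r)) + (h * r - 3 * h\<^sup>2) / r * (- ln (1 - r))
      + (2 * h\<^sup>2 - h * r) / r * Li2 r)
    = h\<^sup>2 / r\<^sup>2 - (1 - r) * (h * r - 3 * h\<^sup>2) / r ^ 3 * ln (1 - r)
      + (1 - r) * (2 * h\<^sup>2 - h * r) / r ^ 3 * Li2 r"
  proof -
    have "(1 - r) / r\<^sup>2 * (g * (1 / (1 - r)) + c / r * (- l) + e / r * D)
      = g / r\<^sup>2 - (1 - r) * c / r ^ 3 * l + (1 - r) * e / r ^ 3 * D" for g c e l D :: real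
    proof -
      have "(1 - r) / r\<^sup>2 * (g * (1 / (1 - r))) = g / r\<^sup>2"
        using r by simp
      moreover have "(1 - r) / r\<^sup>2 * (c / r * (- l)) = - ((1 - r) * c / r ^ 3 * l)"
        "(1 - r) / r\<^sup>2 * (e / r * D) = (1 - r) * e / r ^ 3 * D"
        by (simp_all add: power2_eq_square power3_eq_cube)
      ultimately show ?thesis by (simp only: distrib_left)
    qed
    then show ?thesis .
  qed
  ultimately show ?thesis by simp
qed

text \<open>Dominated convergence: by disjointness each partial sum is \<open>f\<close> restricted
  to a finite union, so \<open>\<bar>f x\<bar>\<close> dominates. It serves to split expectations by
  the values of \<open>N\<close> and \<open>T\<close>.\<close>

lemma integral_sums_disjoint:
  fixes f :: "'a \<Rightarrow> real"
  assumes f: "integrable M f" and A: "\<And>i. A i \<in> sets M" and disj: "disjoint_family A"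
  shows "(\<lambda>i. \<integral>x. indicator (A i) x * f x \<partial>M) sums (\<integral>x. indicator (\<Union>i. A i) x * f x \<partial>M)"
proof -
  have [measurable]: "A i \<in> sets M" for i by (rule A)
  have "(\<lambda>n. \<integral>x. (\<Sum>i<n. indicator (A i) x * f x) \<partial>M)
    \<longlonglongrightarrow> (\<integral>x. indicator (\<Union>i. A i) x * f x \<partial>M)"
  proof (rule integral_dominated_convergence[where w = "\<lambda>x. \<bar>f x\<bar>"])
    fix n
    have "disjoint_family_on A {..<n}"
      using disj by (auto simp: disjoint_family_on_def)
    then have "(\<Sum>i<n. indicator (A i) x * f x) = indicator (\<Union>i<n. A i) x * f x" for x
      by (subst indicator_UN_disjoint) (simp_all add: sum_distrib_right)
    moreover have "norm (indicator B x * f x) \<le> \<bar>f x\<bar>" for B x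
      by (simp add: indicator_def)
    ultimately show "AE x in M. norm (\<Sum>i<n. indicator (A i) x * f x) \<le> \<bar>f x\<bar>"
      by (simp only: AE_I2)
  next
    have "(\<lambda>i. indicator (A i) x * f x) sums (indicator (\<Union>i. A i) x * f x)" for x
      using disj
      by (intro sums_mult2 indicator_sums) (auto simp: disjoint_family_on_def)
    then show "AE x in M. (\<lambda>n. \<Sum>i<n. indicator (A i) x * f x)
        \<longlonglongrightarrow> indicator (\<Union>i. A i) x * f x"
      by (simp add: sums_def)
  qed (use f in auto)
  moreover have "(\<integral>x. (\<Sum>i<n. indicator (A i) x * f x) \<partial>M)
      = (\<Sum>i<n. \<integral>x. indicator (A i) x * f x \<partial>M)" for n
    using integrable_mult_indicator[OF A f] by (intro Bochner_Integration.integral_sum) simp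
  ultimately show ?thesis by (simp add: sums_def)
qed

subsection \<open>Weights of stopped paths\<close>

text \<open>
  For \<open>a = j\<close>, \<open>b = j + k\<close> and \<open>x\<close> the sequence of observations this is \<open>\<phi> V\<close> on the event
  \<open>T > t\<close> when \<open>V\<close> and \<open>N = n + 1\<close> are computed from the first \<open>t\<close> observations.
\<close>

definition stop_weight ::
    "nat \<Rightarrow> nat \<Rightarrow> nat \<Rightarrow> (nat \<Rightarrow> real) \<Rightarrow> nat \<Rightarrow> (nat \<Rightarrow> nat) \<Rightarrow> real" where
  "stop_weight a b n \<phi> t x =
     (if (\<forall>i\<in>{1..t}. x i \<le> b) \<and> card {i\<in>{1..t}. a \<le> x i} = n
      then \<phi> (card {i\<in>{1..t}. x i = a}) else 0)"

lemma card_prefix_Suc: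
  "card {i\<in>{1..Suc t}. P i} = card {i\<in>{1..t}. P i} + of_bool (P (Suc t))"
proof -
  have "{i\<in>{1..Suc t}. P i} = {i\<in>{1..t}. P i} \<union> (if P (Suc t) then {Suc t} else {})"
    by (auto simp: le_Suc_eq)
  then show ?thesis by (auto simp: card_insert_if)
qed

lemma card_eq_le_card_ge:
  fixes x :: "nat \<Rightarrow> nat"
  shows "card {i\<in>{1..t}. x i = a} \<le> card {i\<in>{1..t}. a \<le> x i}"
  by (intro card_mono) auto

text \<open>Dependence on the first \<open>t\<close> entries alone is what gives measurability and
  independence from observation \<open>Suc t\<close>.\<close>

lemma stop_weight_cong:
  assumes "\<forall>i\<in>{1..t}. x i = y i"
  shows "stop_weight a b n \<phi> t x = stop_weight a b n \<phi> t y"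
proof -
  have "{i\<in>{1..t}. a \<le> x i} = {i\<in>{1..t}. a \<le> y i}" "{i\<in>{1..t}. x i = a} = {i\<in>{1..t}. y i = a}"
    using assms by auto
  moreover have "(\<forall>i\<in>{1..t}. x i \<le> b) \<longleftrightarrow> (\<forall>i\<in>{1..t}. y i \<le> b)"
    using assms by auto
  ultimately show ?thesis by (simp only: stop_weight_def)
qed

text \<open>At most \<open>n\<close> entries equal \<open>a\<close>, so only finitely many values of
  \<open>\<phi>\<close> can occur. The remaining indicator supplies geometric decay in
  \<open>t\<close>.\<close>

lemma abs_stop_weight_le:
  "\<bar>stop_weight a b n \<phi> t x\<bar> \<le> (\<Sum>v\<le>n. \<bar>\<phi> v\<bar>) * of_bool (\<forall>i\<in>{1..t}. x i \<le> b)"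
proof (cases "(\<forall>i\<in>{1..t}. x i \<le> b) \<and> card {i\<in>{1..t}. a \<le> x i} = n")
  case True
  then have "card {i\<in>{1..t}. x i = a} \<le> n"
    using card_eq_le_card_ge[of t x a] by simp
  then have "\<bar>\<phi> (card {i\<in>{1..t}. x i = a})\<bar> \<le> (\<Sum>v\<le>n. \<bar>\<phi> v\<bar>)"
    by (intro member_le_sum) auto
  with True show ?thesis by (simp add: stop_weight_def)
next
  case False
  then have "stop_weight a b n \<phi> t x = 0" by (simp only: stop_weight_def if_False)
  then show ?thesis by (simp add: sum_nonneg)
qed

text \<open>Case split on the last entry: below \<open>a\<close> it changes no count, at
  \<open>a\<close> it raises both counts, in \<open>{a<..b}\<close> it raises only the count of
  entries at least \<open>a\<close>, and above \<open>b\<close> the weight vanishes.\<close>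

lemma stop_weight_Suc:
  assumes "a \<le> b"
  shows "stop_weight a b 0 \<phi> (Suc t) x = stop_weight a b 0 \<phi> t x * of_bool (x (Suc t) \<in> {..<a})"
    and "stop_weight a b (Suc n) \<phi> (Suc t) x =
      stop_weight a b (Suc n) \<phi> t x * of_bool (x (Suc t) \<in> {..<a})
      + stop_weight a b n (\<phi> \<circ> Suc) t x * of_bool (x (Suc t) \<in> {a})
      + stop_weight a b n \<phi> t x * of_bool (x (Suc t) \<in> {a<..b})"
proof -
  define A where "A \<longleftrightarrow> (\<forall>i\<in>{1..t}. x i \<le> b)"
  define N where "N = card {i\<in>{1..t}. a \<le> x i}"
  define V where "V = card {i\<in>{1..t}. x i = a}"
  have all: "(\<forall>i\<in>{1..Suc t}. x i \<le> b) \<longleftrightarrow> A \<and> x (Suc t) \<le> b"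
    by (auto simp: A_def le_Suc_eq)
  note unf = stop_weight_def all card_prefix_Suc A_def[symmetric] N_def[symmetric] V_def[symmetric]
  consider "x (Suc t) < a" | "x (Suc t) = a" | "a < x (Suc t)" "x (Suc t) \<le> b" | "b < x (Suc t)"
    using assms by linarith
  note cs = this
  show "stop_weight a b 0 \<phi> (Suc t) x = stop_weight a b 0 \<phi> t x * of_bool (x (Suc t) \<in> {..<a})"
    unfolding unf
    by (cases rule: cs) (use assms in simp_all)
  show "stop_weight a b (Suc n) \<phi> (Suc t) x =
      stop_weight a b (Suc n) \<phi> t x * of_bool (x (Suc t) \<in> {..<a})
      + stop_weight a b n (\<phi> \<circ> Suc) t x * of_bool (x (Suc t) \<in> {a})
      + stop_weight a b n \<phi> t x * of_bool (x (Suc t) \<in> {a<..b})"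
    unfolding unf
    by (cases rule: cs) (use assms in simp_all)
qed

text \<open>Multiplied by \<open>r\<^sup>2\<close>, so that no exponents \<open>n - 1\<close> and \<open>n - 2\<close> occur.\<close>

lemma quadratic_recursion:
  fixes W :: "nat \<Rightarrow> (nat \<Rightarrow> real) \<Rightarrow> real"
  assumes s: "s \<noteq> 0"
    and W0: "\<And>\<phi>. s * W 0 \<phi> = \<phi> 0"
    and W_Suc: "\<And>n \<phi>. s * W (Suc n) \<phi> = p * W n (\<phi> \<circ> Suc) + m * W n \<phi>"
    and h: "h = p / s" and r: "r = (p + m) / s"
  shows "r\<^sup>2 * (s * W n (\<lambda>v. A + B * real v + C * (real v)\<^sup>2)) =
    r ^ n * (A * r\<^sup>2 + B * real n * h * r + C * (real n * h * r + real n * (real n - 1) * h\<^sup>2))"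
proof (induction n arbitrary: A B C)
  case 0
  then show ?case by (simp add: W0 mult.commute)
next
  case (Suc n)
  let ?\<phi> = "\<lambda>A B C v. A + B * real v + C * (real v)\<^sup>2"
  \<comment> \<open>Quadratics are stable under the shift by \<open>Suc\<close>, which is why the
    induction runs over all three coefficients at once.\<close>
  have shift: "?\<phi> A B C \<circ> Suc = ?\<phi> (A + B + C) (B + 2 * C) C"
    by (auto simp: fun_eq_iff algebra_simps power2_eq_square)
  \<comment> \<open>Relative to \<open>s\<close>, one step weighs \<open>h\<close> for a hit and
    \<open>r - h\<close> for a miss, so \<open>s\<close> drops out of the recursion.\<close>
  have pm: "p = h * s" "m = (r - h) * s"
    using s by (simp_all add: h r field_simps)
  have "r\<^sup>2 * (s * W (Suc n) (?\<phi> A B C)) =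
    h * (r\<^sup>2 * (s * W n (?\<phi> (A + B + C) (B + 2 * C) C))) + (r - h) * (r\<^sup>2 * (s * W n (?\<phi> A B C)))"
    unfolding W_Suc shift by (simp add: pm algebra_simps)
  then show ?case
    unfolding Suc.IH by (simp add: algebra_simps power2_eq_square)
qed

subsection \<open>Independent and identically distributed observations\<close>

locale iid_nat = prob_space M for M :: "'a measure" +
  fixes X :: "nat \<Rightarrow> 'a \<Rightarrow> nat"
  assumes indep: "indep_vars (\<lambda>_. count_space UNIV) X {1..}"
    and ident: "\<And>i. i \<ge> 1 \<Longrightarrow> distr M (count_space UNIV) (X i) = distr M (count_space UNIV) (X 1)"
begin

abbreviation obs :: "'a \<Rightarrow> nat \<Rightarrow> nat" where
  "obs \<omega> \<equiv> \<lambda>i. X i \<omega>"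

lemma X_measurable [measurable]: "i \<ge> 1 \<Longrightarrow> X i \<in> measurable M (count_space UNIV)"
  using indep by (auto simp: indep_vars_def)

lemma prob_X_eq: "i \<ge> 1 \<Longrightarrow> prob {\<omega>\<in>space M. X i \<omega> \<in> S} = prob {\<omega>\<in>space M. X 1 \<omega> \<in> S}"
  using arg_cong[OF ident[of i], of "\<lambda>N. measure N S"]
  by (simp add: measure_distr vimage_def Int_def conj_commute)

text \<open>A finite product of copies of the discrete space of naturals is again discrete, so every
  function of the first \<open>t\<close> observations is measurable.\<close>

lemma measurable_path:
  fixes g :: "(nat \<Rightarrow> nat) \<Rightarrow> real"
  assumes "\<And>x y. \<forall>i\<in>{1..t}. x i = y i \<Longrightarrow> g x = g y"
  shows "(\<lambda>\<omega>. g (obs \<omega>)) \<in> borel_measurable M"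
proof -
  have "(\<lambda>\<omega>. restrict (obs \<omega>) {1..t}) \<in> measurable M (PiM {1..t} (\<lambda>_. count_space UNIV))"
    by (rule measurable_restrict) auto
  moreover have "PiM {1..t} (\<lambda>_. count_space UNIV) = count_space (PiE {1..t} (\<lambda>_. UNIV :: nat set))"
    by (rule count_space_PiM_finite) auto
  ultimately have "(\<lambda>\<omega>. g (restrict (obs \<omega>) {1..t})) \<in> borel_measurable M"
    by (metis measurable_compose measurable_count_space_eq1 Pi_UNIV UNIV_I space_borel)
  moreover have "g (restrict (obs \<omega>) {1..t}) = g (obs \<omega>)" for \<omega>
    by (rule assms) auto
  ultimately show ?thesis by simp
qed

lemma integrable_path:
  fixes g :: "(nat \<Rightarrow> nat) \<Rightarrow> real"
  assumes "\<And>x y. \<forall>i\<in>{1..t}. x i = y i \<Longrightarrow> g x = g y" "\<And>x. \<bar>g x\<bar> \<le> C"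
  shows "integrable M (\<lambda>\<omega>. g (obs \<omega>))"
  using assms(2) by (intro integrable_const_bound[of _ C] measurable_path[of t]) (auto intro: assms)

text \<open>The blocks \<open>{1..t}\<close> and \<open>{Suc t}\<close> of an independent family are
  independent; identical distribution then replaces \<open>X (Suc t)\<close> by
  \<open>X 1\<close>.\<close>

lemma expectation_mult_next:
  fixes g :: "(nat \<Rightarrow> nat) \<Rightarrow> real"
  assumes g: "\<And>x y. \<forall>i\<in>{1..t}. x i = y i \<Longrightarrow> g x = g y" and bound: "\<And>x. \<bar>g x\<bar> \<le> C"
  shows "expectation (\<lambda>\<omega>. g (obs \<omega>) * of_bool (X (Suc t) \<omega> \<in> S))
    = expectation (\<lambda>\<omega>. g (obs \<omega>)) * prob {\<omega>\<in>space M. X 1 \<omega> \<in> S}"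
proof -
  let ?P = "\<lambda>A. PiM A (\<lambda>_. count_space (UNIV :: nat set))"
  let ?h = "\<lambda>x. of_bool (x (Suc t) \<in> S) :: real"
  have P: "?P A = count_space (PiE A (\<lambda>_. UNIV))" if "finite A" for A
    using that by (rule count_space_PiM_finite) auto
  have "indep_var (?P {1..t}) (\<lambda>\<omega>. restrict (obs \<omega>) {1..t})
                  (?P {Suc t}) (\<lambda>\<omega>. restrict (obs \<omega>) {Suc t})"
    by (rule indep_var_restrict[OF indep]) auto
  then have "indep_var borel (g \<circ> (\<lambda>\<omega>. restrict (obs \<omega>) {1..t}))
                       borel (?h \<circ> (\<lambda>\<omega>. restrict (obs \<omega>) {Suc t}))"
    by (rule indep_var_compose) (simp_all add: P)
  moreover have "g \<circ> (\<lambda>\<omega>. restrict (obs \<omega>) {1..t}) = (\<lambda>\<omega>. g (obs \<omega>))"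
    by (auto simp: fun_eq_iff intro!: g)
  moreover have "?h \<circ> (\<lambda>\<omega>. restrict (obs \<omega>) {Suc t}) = (\<lambda>\<omega>. of_bool (X (Suc t) \<omega> \<in> S))"
    by (auto simp: fun_eq_iff)
  ultimately have ind: "indep_var borel (\<lambda>\<omega>. g (obs \<omega>)) borel (\<lambda>\<omega>. of_bool (X (Suc t) \<omega> \<in> S) :: real)"
    by simp
  have "integrable M (\<lambda>\<omega>. of_bool (X (Suc t) \<omega> \<in> S) :: real)"
    using integrable_path[of "Suc t" ?h 1] by auto
  from indep_var_lebesgue_integral[OF ind integrable_path[of t g C, OF g bound] this]
  have "expectation (\<lambda>\<omega>. g (obs \<omega>) * of_bool (X (Suc t) \<omega> \<in> S))
    = expectation (\<lambda>\<omega>. g (obs \<omega>)) * expectation (\<lambda>\<omega>. of_bool (X (Suc t) \<omega> \<in> S))" .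
  also have "expectation (\<lambda>\<omega>. of_bool (X (Suc t) \<omega> \<in> S)) = prob {\<omega>\<in>space M. X (Suc t) \<omega> \<in> S}"
  proof -
    have "expectation (\<lambda>\<omega>. of_bool (X (Suc t) \<omega> \<in> S))
      = expectation (indicator {\<omega>\<in>space M. X (Suc t) \<omega> \<in> S})"
      by (intro Bochner_Integration.integral_cong) (auto simp: indicator_def)
    also have "\<dots> = prob ({\<omega>\<in>space M. X (Suc t) \<omega> \<in> S} \<inter> space M)"
      by (rule Bochner_Integration.integral_indicator)
    also have "{\<omega>\<in>space M. X (Suc t) \<omega> \<in> S} \<inter> space M = {\<omega>\<in>space M. X (Suc t) \<omega> \<in> S}"
      by auto
    finally show ?thesis .
  qed
  finally show ?thesis using prob_X_eq[of "Suc t" S] by simp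
qed

text \<open>Each term is a function of finitely many observations, and \<open>suminf\<close> of
  measurable functions is measurable even at points of divergence. The predicate \<open>Q\<close>
  covers both conditions on the running maximum.\<close>

lemma borel_measurable_count_A: "count_A X m l \<in> borel_measurable M"
proof -
  have "(\<lambda>\<omega>. of_bool (i \<ge> 2 \<and> X i \<omega> = m \<and> Q (running_max X (i - 1) \<omega>)) :: real)
      \<in> borel_measurable M" for i Q
    unfolding running_max_def
  proof (rule measurable_path[of i "\<lambda>x. of_bool (i \<ge> 2 \<and> x i = m \<and> Q (Max (x ` {1..i - 1})))"])
    fix x y :: "nat \<Rightarrow> nat" assume *: "\<forall>n\<in>{1..i}. x n = y n"
    then have "x ` {1..i - 1} = y ` {1..i - 1}"
      by (intro image_cong) auto
    with * show "(of_bool (i \<ge> 2 \<and> x i = m \<and> Q (Max (x ` {1..i - 1}))) :: real)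
      = of_bool (i \<ge> 2 \<and> y i = m \<and> Q (Max (y ` {1..i - 1})))"
      by auto
  qed
  then have series: "(\<lambda>\<omega>. \<Sum>i. of_bool (i \<ge> 2 \<and> X i \<omega> = m \<and> Q (running_max X (i - 1) \<omega>)) :: real)
      \<in> borel_measurable M" for Q
    by (rule borel_measurable_suminf)
  have first: "(\<lambda>\<omega>. of_bool (X 1 \<omega> = m) :: real) \<in> borel_measurable M"
    by (rule measurable_path[of 1 "\<lambda>x. of_bool (x 1 = m)"]) auto
  show ?thesis
  proof (cases "l = 0")
    case True
    then have "count_A X m l = (\<lambda>\<omega>. of_bool (X 1 \<omega> = m)
      + (\<Sum>i. of_bool (i \<ge> 2 \<and> X i \<omega> = m \<and> running_max X (i - 1) \<omega> \<le> m)))"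
      by (simp add: count_A_def[abs_def])
    then show ?thesis
      using borel_measurable_add[OF first series[of "\<lambda>r. r \<le> m"]] by (simp only:)
  next
    case False
    then have "count_A X m l = (\<lambda>\<omega>.
      \<Sum>i. of_bool (i \<ge> 2 \<and> X i \<omega> = m \<and> running_max X (i - 1) \<omega> = m + l))"
      by (simp add: count_A_def[abs_def])
    then show ?thesis
      using series[of "\<lambda>r. r = m + l"] by (simp only:)
  qed
qed

lemma borel_measurable_hazard_est [measurable]: "hazard_est X j k \<in> borel_measurable M"
  unfolding hazard_est_def count_N_def count_V_def
  by (intro borel_measurable_divide borel_measurable_add borel_measurable_sum
    borel_measurable_const borel_measurable_count_A)

lemma sets_path:
  assumes "\<And>x y. \<forall>i\<in>{1..t}. x i = y i \<Longrightarrow> P x = P y"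
  shows "{\<omega>\<in>space M. P (obs \<omega>)} \<in> sets M"
proof -
  have "(\<lambda>\<omega>. of_bool (P (obs \<omega>)) :: real) \<in> borel_measurable M"
    by (rule measurable_path[of t "\<lambda>x. of_bool (P x)"]) (intro arg_cong[of _ _ of_bool] assms)
  from measurable_sets[OF this, of "{1}"]
  have "(\<lambda>\<omega>. of_bool (P (obs \<omega>)) :: real) -` {1} \<inter> space M \<in> sets M" by simp
  also have "(\<lambda>\<omega>. of_bool (P (obs \<omega>)) :: real) -` {1} \<inter> space M = {\<omega>\<in>space M. P (obs \<omega>)}"
    by auto
  finally show ?thesis .
qed

section \<open>The law of a single observation\<close>

abbreviation law :: "nat set \<Rightarrow> real" where
  "law S \<equiv> prob {\<omega>\<in>space M. X 1 \<omega> \<in> S}"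

lemma event_X1 [measurable]: "{\<omega>\<in>space M. X 1 \<omega> \<in> S} \<in> sets M"
  by (rule sets_path[of 1 "\<lambda>x. x 1 \<in> S"]) auto

lemma law_Un: "S \<inter> T = {} \<Longrightarrow> law (S \<union> T) = law S + law T"
  by (subst finite_measure_Union[symmetric]) (auto intro!: arg_cong[where f = prob])

lemma law_compl: "law (- S) = 1 - law S"
  using law_Un[of S "- S"] by (simp add: prob_space)

lemma expectation_below:
  "expectation (\<lambda>\<omega>. of_bool (\<forall>i\<in>{1..t}. X i \<omega> \<le> b) :: real) = law {..b} ^ t"
proof (induction t)
  case (Suc t)
  have "expectation (\<lambda>\<omega>. of_bool (\<forall>i\<in>{1..Suc t}. X i \<omega> \<le> b) :: real)
    = expectation (\<lambda>\<omega>. of_bool (\<forall>i\<in>{1..t}. X i \<omega> \<le> b) * of_bool (X (Suc t) \<omega> \<in> {..b}))"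
    by (intro Bochner_Integration.integral_cong) (auto simp: le_Suc_eq)
  also have "\<dots> = law {..b} ^ t * law {..b}"
    using expectation_mult_next[of t "\<lambda>x. of_bool (\<forall>i\<in>{1..t}. x i \<le> b)" 1 "{..b}"] Suc by simp
  finally show ?case by simp
qed (simp add: prob_space)

section \<open>Expected weights and their recursion\<close>

lemma integrable_stop_weight: "integrable M (\<lambda>\<omega>. stop_weight a b n \<phi> t (obs \<omega>))"
proof (rule integrable_path)
  show "\<bar>stop_weight a b n \<phi> t x\<bar> \<le> (\<Sum>v\<le>n. \<bar>\<phi> v\<bar>)" for x
    by (rule order_trans[OF abs_stop_weight_le]) (simp add: sum_nonneg mult_left_le)
qed (rule stop_weight_cong)

lemma expectation_stop_weight_next:
  "expectation (\<lambda>\<omega>. stop_weight a b n \<phi> t (obs \<omega>) * of_bool (X (Suc t) \<omega> \<in> S))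
    = expectation (\<lambda>\<omega>. stop_weight a b n \<phi> t (obs \<omega>)) * law S"
proof (rule expectation_mult_next)
  show "\<bar>stop_weight a b n \<phi> t x\<bar> \<le> (\<Sum>v\<le>n. \<bar>\<phi> v\<bar>)" for x
    by (rule order_trans[OF abs_stop_weight_le]) (simp add: sum_nonneg mult_left_le)
qed (rule stop_weight_cong)

lemma integrable_stop_weight_next:
  "integrable M (\<lambda>\<omega>. stop_weight a b n \<phi> t (obs \<omega>) * of_bool (X (Suc t) \<omega> \<in> S))"
proof (rule integrable_path[of "Suc t" "\<lambda>x. stop_weight a b n \<phi> t x * of_bool (x (Suc t) \<in> S)"])
  show "\<bar>stop_weight a b n \<phi> t x * of_bool (x (Suc t) \<in> S)\<bar> \<le> (\<Sum>v\<le>n. \<bar>\<phi> v\<bar>)" for x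
    using order_trans[OF abs_stop_weight_le[of a b n \<phi> t x], of "\<Sum>v\<le>n. \<bar>\<phi> v\<bar>"]
    by (simp add: sum_nonneg mult_left_le abs_mult)
  show "stop_weight a b n \<phi> t x * of_bool (x (Suc t) \<in> S) = stop_weight a b n \<phi> t y * of_bool (y (Suc t) \<in> S)"
    if "\<forall>i\<in>{1..Suc t}. x i = y i" for x y
    using that stop_weight_cong[of t x y a b n \<phi>] by simp
qed

text \<open>Multiplied by \<open>law {b<..}\<close>, the chance that the next observation ends the
  path, this is the expectation of \<open>\<phi> V\<close> on \<open>N = n + 1\<close> when
  \<open>a = j\<close> and \<open>b = j + k\<close>.\<close>

definition stop_total :: "nat \<Rightarrow> nat \<Rightarrow> nat \<Rightarrow> (nat \<Rightarrow> real) \<Rightarrow> real" where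
  "stop_total a b n \<phi> = (\<Sum>t. expectation (\<lambda>\<omega>. stop_weight a b n \<phi> t (obs \<omega>)))"

text \<open>The terms are dominated by a geometric sequence with ratio
  \<open>law {..b}\<close>.\<close>

lemma summable_stop_weight:
  assumes "law {..b} < 1"
  shows "summable (\<lambda>t. expectation (\<lambda>\<omega>. stop_weight a b n \<phi> t (obs \<omega>)))"
proof (rule summable_comparison_test'[of _ 0])
  show "summable (\<lambda>t. (\<Sum>v\<le>n. \<bar>\<phi> v\<bar>) * law {..b} ^ t)"
    using assms by (intro summable_mult summable_geometric) simp
  show "norm (expectation (\<lambda>\<omega>. stop_weight a b n \<phi> t (obs \<omega>))) \<le> (\<Sum>v\<le>n. \<bar>\<phi> v\<bar>) * law {..b} ^ t" for t
  proof -
    have below: "integrable M (\<lambda>\<omega>. of_bool (\<forall>i\<in>{1..t}. X i \<omega> \<le> b) :: real)"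
      by (rule integrable_path[of t "\<lambda>x. of_bool (\<forall>i\<in>{1..t}. x i \<le> b)" 1]) auto
    have "norm (expectation (\<lambda>\<omega>. stop_weight a b n \<phi> t (obs \<omega>)))
      \<le> expectation (\<lambda>\<omega>. norm (stop_weight a b n \<phi> t (obs \<omega>)))"
      by (rule integral_norm_bound)
    also have "\<dots> \<le> expectation (\<lambda>\<omega>. (\<Sum>v\<le>n. \<bar>\<phi> v\<bar>) * of_bool (\<forall>i\<in>{1..t}. X i \<omega> \<le> b))"
      using abs_stop_weight_le[of a b n \<phi> t]
      by (intro integral_mono integrable_norm integrable_stop_weight integrable_mult_right below) auto
    also have "\<dots> = (\<Sum>v\<le>n. \<bar>\<phi> v\<bar>) * law {..b} ^ t"
      by (simp only: integral_mult_right_zero expectation_below)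
    finally show ?thesis .
  qed
qed

text \<open>The split by the last entry is summed over \<open>t\<close>. Entries below
  \<open>a\<close> reproduce the same total, and moving that term to the left gives the factor
  \<open>1 - law {..<a}\<close>.\<close>

lemma stop_total_rec:
  assumes "a \<le> b" "law {..b} < 1"
  shows "(1 - law {..<a}) * stop_total a b 0 \<phi> = \<phi> 0"
    and "(1 - law {..<a}) * stop_total a b (Suc n) \<phi> =
      law {a} * stop_total a b n (\<phi> \<circ> Suc) + law {a<..b} * stop_total a b n \<phi>"
proof -
  let ?e = "\<lambda>n \<phi> t. expectation (\<lambda>\<omega>. stop_weight a b n \<phi> t (obs \<omega>))"
  note sm = summable_stop_weight[OF assms(2), of a]
  \<comment> \<open>The empty path \<open>t = 0\<close> is set apart; it contributes
    \<open>\<phi> 0\<close> for \<open>n = 0\<close> and nothing otherwise.\<close>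
  have split: "stop_total a b n \<phi> = ?e n \<phi> 0 + (\<Sum>t. ?e n \<phi> (Suc t))" for n \<phi>
    unfolding stop_total_def using suminf_split_head[OF sm] by simp
  have "?e 0 \<phi> (Suc t) = ?e 0 \<phi> t * law {..<a}" for t
    unfolding stop_weight_Suc(1)[OF assms(1)] by (rule expectation_stop_weight_next)
  then have "(\<Sum>t. ?e 0 \<phi> (Suc t)) = stop_total a b 0 \<phi> * law {..<a}"
    unfolding stop_total_def by (simp only: suminf_mult2[OF sm])
  moreover have "?e 0 \<phi> 0 = \<phi> 0"
    by (simp add: stop_weight_def prob_space)
  ultimately have "stop_total a b 0 \<phi> = \<phi> 0 + stop_total a b 0 \<phi> * law {..<a}"
    using split[of 0 \<phi>] by (simp only:)
  then show "(1 - law {..<a}) * stop_total a b 0 \<phi> = \<phi> 0"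
    by algebra
  have "?e (Suc n) \<phi> (Suc t) = ?e (Suc n) \<phi> t * law {..<a} + ?e n (\<phi> \<circ> Suc) t * law {a}
      + ?e n \<phi> t * law {a<..b}" for t
    unfolding stop_weight_Suc(2)[OF assms(1)]
    by (simp only: Bochner_Integration.integral_add integrable_stop_weight_next
      Bochner_Integration.integrable_add expectation_stop_weight_next)
  moreover have "?e (Suc n) \<phi> 0 = 0"
    by (simp add: stop_weight_def)
  ultimately have "stop_total a b (Suc n) \<phi> =
      (\<Sum>t. ?e (Suc n) \<phi> t * law {..<a} + ?e n (\<phi> \<circ> Suc) t * law {a} + ?e n \<phi> t * law {a<..b})"
    unfolding split[of "Suc n"] by (simp only: add_0_left)
  also have "\<dots> = stop_total a b (Suc n) \<phi> * law {..<a} + stop_total a b n (\<phi> \<circ> Suc) * law {a}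
      + stop_total a b n \<phi> * law {a<..b}"
    unfolding stop_total_def
    by (simp only: suminf_add[symmetric] suminf_mult2 sm summable_mult2 summable_add)
  finally show "(1 - law {..<a}) * stop_total a b (Suc n) \<phi> =
      law {a} * stop_total a b n (\<phi> \<circ> Suc) + law {a<..b} * stop_total a b n \<phi>"
    by algebra
qed

section \<open>Decomposition by the first exceedance, with \<open>T = t + 1\<close> on
  \<open>stopped b t\<close>\<close>

definition stopped :: "nat \<Rightarrow> nat \<Rightarrow> 'a set" where
  "stopped b t = {\<omega>\<in>space M. (\<forall>i\<in>{1..t}. X i \<omega> \<le> b) \<and> X (Suc t) \<omega> > b}"

lemma sets_stopped: "stopped b t \<in> sets M"
  unfolding stopped_def
proof (rule sets_path[of "Suc t" "\<lambda>x. (\<forall>i\<in>{1..t}. x i \<le> b) \<and> x (Suc t) > b"])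
  fix x y :: "nat \<Rightarrow> nat" assume "\<forall>i\<in>{1..Suc t}. x i = y i"
  then have "\<forall>i\<in>{1..t}. x i = y i" "x (Suc t) = y (Suc t)" by auto
  then show "((\<forall>i\<in>{1..t}. x i \<le> b) \<and> x (Suc t) > b) = ((\<forall>i\<in>{1..t}. y i \<le> b) \<and> y (Suc t) > b)"
    by simp
qed

lemma stopped_unique:
  assumes "\<omega> \<in> stopped b t" "\<omega> \<in> stopped b u"
  shows "t = u"
proof -
  have "\<not> t < u" if "\<omega> \<in> stopped b t" "\<omega> \<in> stopped b u" for t u
  proof
    assume "t < u"
    then have "Suc t \<in> {1..u}" by simp
    with that(2) have "X (Suc t) \<omega> \<le> b" unfolding stopped_def by blast
    with that(1) show False by (simp add: stopped_def)
  qed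
  then show ?thesis using assms by (meson linorder_neqE_nat)
qed

text \<open>The disjoint events have probabilities \<open>law {..b} ^ t * (1 - law {..b})\<close>, a
  geometric series with sum \<open>1\<close>.\<close>

lemma AE_stopped:
  assumes "law {..b} < 1"
  shows "AE \<omega> in M. \<exists>t. \<omega> \<in> stopped b t"
proof -
  have "prob (stopped b t) = law {..b} ^ t * (1 - law {..b})" for t
  proof -
    have "prob (stopped b t) = expectation (indicator (stopped b t))"
      using sets_stopped[of b t] by (simp add: sets.Int_space_eq2)
    also have "\<dots> = expectation (\<lambda>\<omega>. of_bool (\<forall>i\<in>{1..t}. X i \<omega> \<le> b) * of_bool (X (Suc t) \<omega> \<in> - {..b}))"
      by (intro Bochner_Integration.integral_cong) (auto simp: stopped_def)
    also have "\<dots> = expectation (\<lambda>\<omega>. of_bool (\<forall>i\<in>{1..t}. X i \<omega> \<le> b)) * law (- {..b})"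
      by (rule expectation_mult_next[of t "\<lambda>x. of_bool (\<forall>i\<in>{1..t}. x i \<le> b)" 1 "- {..b}"]) auto
    finally show ?thesis by (simp only: expectation_below law_compl)
  qed
  moreover have "(\<lambda>t. law {..b} ^ t * (1 - law {..b})) sums (1 / (1 - law {..b}) * (1 - law {..b}))"
    using assms by (intro sums_mult2 geometric_sums) simp
  moreover have "(\<lambda>t. prob (stopped b t)) sums prob (\<Union>t. stopped b t)"
    using stopped_unique sets_stopped
    by (intro finite_measure_UNION) (auto simp: disjoint_family_on_def)
  ultimately have "prob (\<Union>t. stopped b t) = 1"
    using assms sums_unique2 by fastforce
  then have "AE \<omega> in M. \<omega> \<in> (\<Union>t. stopped b t)"
    using sets_stopped by (subst (asm) prob_eq_1) auto
  then show ?thesis by simp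
qed

text \<open>The expectation is split first by \<open>N = n + 1\<close> and then by
  \<open>T = t + 1\<close>. On each piece \<open>f\<close> is a stopped weight times the indicator
  that observation \<open>Suc t\<close> exceeds \<open>b\<close>, and independence factors out
  \<open>law {b<..}\<close>.\<close>

lemma expectation_sums_stop_total:
  assumes lt: "law {..b} < 1" and f: "integrable M f"
    and f_eq: "\<And>t \<omega>. \<omega> \<in> stopped b t \<Longrightarrow>
      f \<omega> = \<psi> (card {i\<in>{1..t}. a \<le> X i \<omega>}) (card {i\<in>{1..t}. X i \<omega> = a})"
  shows "(\<lambda>n. law {b<..} * stop_total a b n (\<psi> n)) sums expectation f"
proof -
  let ?D = "\<lambda>n t. stopped b t \<inter> {\<omega>\<in>space M. card {i\<in>{1..t}. a \<le> X i \<omega>} = n}"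
  have D: "?D n t \<in> sets M" for n t
  proof (intro sets.Int sets_stopped sets_path[of t "\<lambda>x. card {i\<in>{1..t}. a \<le> x i} = n"])
    fix x y :: "nat \<Rightarrow> nat" assume "\<forall>i\<in>{1..t}. x i = y i"
    then have "{i\<in>{1..t}. a \<le> x i} = {i\<in>{1..t}. a \<le> y i}" by auto
    then show "(card {i\<in>{1..t}. a \<le> x i} = n) = (card {i\<in>{1..t}. a \<le> y i} = n)" by simp
  qed
  have D_unique: "n = n' \<and> t = t'" if "\<omega> \<in> ?D n t" "\<omega> \<in> ?D n' t'" for \<omega> n n' t t'
    using that stopped_unique[of \<omega> b t t'] by blast
  have outer: "(\<lambda>n. \<integral>\<omega>. indicator (\<Union>t. ?D n t) \<omega> * f \<omega> \<partial>M)
    sums (\<integral>\<omega>. indicator (\<Union>n. \<Union>t. ?D n t) \<omega> * f \<omega> \<partial>M)"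
  proof (intro integral_sums_disjoint f sets.countable_UN)
    show "disjoint_family (\<lambda>n. \<Union>t. ?D n t)"
      unfolding disjoint_family_on_def using D_unique by blast
  qed (use D in blast)
  have inner: "(\<integral>\<omega>. indicator (\<Union>t. ?D n t) \<omega> * f \<omega> \<partial>M) = law {b<..} * stop_total a b n (\<psi> n)" for n
  proof -
    have "(\<lambda>t. \<integral>\<omega>. indicator (?D n t) \<omega> * f \<omega> \<partial>M) sums (\<integral>\<omega>. indicator (\<Union>t. ?D n t) \<omega> * f \<omega> \<partial>M)"
    proof (intro integral_sums_disjoint f D)
      show "disjoint_family (?D n)"
        unfolding disjoint_family_on_def using D_unique by blast
    qed
    moreover have "(\<integral>\<omega>. indicator (?D n t) \<omega> * f \<omega> \<partial>M)
        = expectation (\<lambda>\<omega>. stop_weight a b n (\<psi> n) t (obs \<omega>)) * law {b<..}" for t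
    proof -
      have "(\<integral>\<omega>. indicator (?D n t) \<omega> * f \<omega> \<partial>M)
        = expectation (\<lambda>\<omega>. stop_weight a b n (\<psi> n) t (obs \<omega>) * of_bool (X (Suc t) \<omega> \<in> {b<..}))"
      proof (intro Bochner_Integration.integral_cong refl)
        fix \<omega> assume \<omega>: "\<omega> \<in> space M"
        show "indicator (?D n t) \<omega> * f \<omega>
          = stop_weight a b n (\<psi> n) t (obs \<omega>) * of_bool (X (Suc t) \<omega> \<in> {b<..})"
        proof (cases "\<omega> \<in> ?D n t")
          case True
          then have "(\<forall>i\<in>{1..t}. X i \<omega> \<le> b) \<and> card {i\<in>{1..t}. a \<le> X i \<omega>} = n" "X (Suc t) \<omega> > b"
            by (auto simp: stopped_def)
          with True show ?thesis
            using f_eq[of \<omega> t] by (simp add: stop_weight_def)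
        next
          case False
          with \<omega> consider "\<not> ((\<forall>i\<in>{1..t}. X i \<omega> \<le> b) \<and> card {i\<in>{1..t}. a \<le> X i \<omega>} = n)"
            | "X (Suc t) \<omega> \<notin> {b<..}"
            unfolding stopped_def by blast
          then have "stop_weight a b n (\<psi> n) t (obs \<omega>) * of_bool (X (Suc t) \<omega> \<in> {b<..}) = 0"
            by cases (simp_all only: stop_weight_def if_False mult_zero_left mult_zero_right of_bool_eq)
          moreover have "indicator (?D n t) \<omega> = (0 :: real)"
            using False by (rule indicator_simps(2))
          ultimately show ?thesis by (simp only: mult_zero_left)
        qed
      qed
      then show ?thesis by (simp only: expectation_stop_weight_next)
    qed
    ultimately show ?thesis
      using sums_mult2[OF summable_sums[OF summable_stop_weight[OF lt, of a n "\<psi> n"]], of "law {b<..}"]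
      by (simp add: stop_total_def sums_unique2 mult.commute)
  qed
  \<comment> \<open>The pieces cover the space up to a null set, because an exceedance occurs almost
    surely.\<close>
  have "(\<integral>\<omega>. indicator (\<Union>n. \<Union>t. ?D n t) \<omega> * f \<omega> \<partial>M) = expectation f"
  proof (rule integral_cong_AE)
    show "(\<lambda>\<omega>. indicator (\<Union>n. \<Union>t. ?D n t) \<omega> * f \<omega>) \<in> borel_measurable M"
      using f D by (intro borel_measurable_times borel_measurable_indicator sets.countable_UN) blast+
    show "AE \<omega> in M. indicator (\<Union>n. \<Union>t. ?D n t) \<omega> * f \<omega> = f \<omega>"
      using AE_stopped[OF lt]
    proof eventually_elim
      case (elim \<omega>)
      then have "\<omega> \<in> (\<Union>n. \<Union>t. ?D n t)" by (auto simp: stopped_def)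
      then show ?case by (simp only: indicator_simps mult_1_left)
    qed
  qed (use f in auto)
  with outer show ?thesis by (simp only: inner)
qed

section \<open>Moments of the estimator\<close>

lemma hazard_est_stopped:
  assumes "\<omega> \<in> stopped (j + k) t"
  shows "hazard_est X j k \<omega>
    = real (card {i\<in>{1..t}. X i \<omega> = j}) / real (Suc (card {i\<in>{1..t}. j \<le> X i \<omega>}))"
proof -
  have "\<forall>i\<in>{1..t}. X i \<omega> \<le> j + k" "X (Suc t) \<omega> > j + k"
    using assms by (auto simp: stopped_def)
  then show ?thesis
    unfolding hazard_est_def by (simp only: count_V_until count_N_until)
qed

text \<open>On a stopped path the numerator counts a subset of what the denominator counts, so the
  ratio is at most \<open>1\<close>; almost every path is stopped.\<close>

lemma AE_hazard_est_bounded: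
  assumes "law {..j + k} < 1"
  shows "AE \<omega> in M. \<bar>hazard_est X j k \<omega>\<bar> \<le> 1"
  using AE_stopped[OF assms]
proof eventually_elim
  case (elim \<omega>)
  then obtain t where "\<omega> \<in> stopped (j + k) t" by blast
  then show ?case
    using card_eq_le_card_ge[of t "obs \<omega>" j] by (simp add: hazard_est_stopped)
qed

lemma integrable_hazard_est_power:
  assumes "law {..j + k} < 1"
  shows "integrable M (\<lambda>\<omega>. hazard_est X j k \<omega> ^ e)"
proof (rule integrable_const_bound[of _ 1])
  show "AE \<omega> in M. norm (hazard_est X j k \<omega> ^ e) \<le> 1"
    using AE_hazard_est_bounded[OF assms] by eventually_elim (simp add: power_abs power_le_one)
qed measurable

text \<open>Given that an observation is at least \<open>j\<close>, \<open>h\<close> is the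
  probability that it equals \<open>j\<close> and \<open>r\<close> the probability that it is at
  most \<open>j + k\<close>. The recursion for \<open>stop_total\<close> thus yields the summands of
  the two moment series.\<close>

lemma hazard_est_moments:
  assumes q: "law {j + k<..} > 0" and r_pos: "law {j..j + k} > 0"
    and h: "h = law {j} / law {j..}" and r: "r = law {j..j + k} / law {j..}"
  shows "expectation (hazard_est X j k) = (1 - r) * h / r\<^sup>2 * ln (1 - r) + h / r"
    and "expectation (\<lambda>\<omega>. (hazard_est X j k \<omega>)\<^sup>2)
      = h\<^sup>2 / r\<^sup>2 - (1 - r) * (h * r - 3 * h\<^sup>2) / r ^ 3 * ln (1 - r)
      + (1 - r) * (2 * h\<^sup>2 - h * r) / r ^ 3 * Li2 r"
proof -
  let ?b = "j + k" and ?s = "law {j..}"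
  have "- {..?b} = {?b<..}" by auto
  then have lt: "law {..?b} < 1" using q law_compl[of "{..?b}"] by simp
  have s: "?s = law {j..?b} + law {?b<..}"
  proof -
    have "{j..} = {j..?b} \<union> {?b<..}" by auto
    then show ?thesis by (simp only:) (rule law_Un, auto)
  qed
  have pm: "law {j..?b} = law {j} + law {j<..?b}"
  proof -
    have "{j..?b} = {j} \<union> {j<..?b}" by auto
    then show ?thesis by (simp only:) (rule law_Un, auto)
  qed
  have s_compl: "1 - law {..<j} = ?s"
  proof -
    have "- {..<j} = {j..}" by auto
    then show ?thesis using law_compl[of "{..<j}"] by simp
  qed
  have s_pos: "?s > 0" using s q r_pos by linarith
  have r01: "0 < r" "r < 1" and q_eq: "law {?b<..} = (1 - r) * ?s"
    using s q r_pos s_pos by (simp_all add: r field_simps)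
  have rec: "r\<^sup>2 * (?s * stop_total j ?b n (\<lambda>v. A + B * real v + C * (real v)\<^sup>2)) =
      r ^ n * (A * r\<^sup>2 + B * real n * h * r + C * (real n * h * r + real n * (real n - 1) * h\<^sup>2))" for n A B C
  proof (rule quadratic_recursion[OF _ _ _ h])
    show "?s * stop_total j ?b 0 \<phi> = \<phi> 0" for \<phi>
      using stop_total_rec(1)[of j ?b \<phi>] lt unfolding s_compl by simp
    show "?s * stop_total j ?b (Suc n) \<phi>
        = law {j} * stop_total j ?b n (\<phi> \<circ> Suc) + law {j<..?b} * stop_total j ?b n \<phi>" for n \<phi>
      using stop_total_rec(2)[of j ?b n \<phi>] lt unfolding s_compl by simp
  qed (use s_pos pm r in simp_all)
  have total: "law {?b<..} * stop_total j ?b n (\<lambda>v. A + B * real v + C * (real v)\<^sup>2) =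
      (1 - r) * (r ^ n * (A * r\<^sup>2 + B * real n * h * r + C * (real n * h * r + real n * (real n - 1) * h\<^sup>2))) / r\<^sup>2"
    for n A B C
    unfolding rec[symmetric] q_eq using r01 by simp
  \<comment> \<open>The coefficients \<open>0\<close>, \<open>1 / (n + 1)\<close>, \<open>0\<close>
    encode \<open>V / N\<close>; the full quadratic form is kept so that \<open>total\<close>
    rewrites it.\<close>
  have "(\<lambda>n. law {?b<..} * stop_total j ?b n (\<lambda>v. 0 + 1 / real (Suc n) * real v + 0 * (real v)\<^sup>2))
      sums expectation (hazard_est X j k)"
    using integrable_hazard_est_power[OF lt, of 1]
    by (intro expectation_sums_stop_total[OF lt]) (simp_all add: hazard_est_stopped)
  then have "(\<lambda>n. (1 - r) * (r ^ n * (1 / real (Suc n) * real n * h * r)) / r\<^sup>2)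
      sums expectation (hazard_est X j k)"
    unfolding total by simp
  from sums_unique2[OF this sums_first_moment[OF r01]]
  show "expectation (hazard_est X j k) = (1 - r) * h / r\<^sup>2 * ln (1 - r) + h / r" .
  have "(\<lambda>n. law {?b<..} * stop_total j ?b n (\<lambda>v. 0 + 0 * real v + 1 / (real (Suc n))\<^sup>2 * (real v)\<^sup>2))
      sums expectation (\<lambda>\<omega>. (hazard_est X j k \<omega>)\<^sup>2)"
    using integrable_hazard_est_power[OF lt, of 2]
    by (intro expectation_sums_stop_total[OF lt]) (simp_all add: hazard_est_stopped power_divide)
  then have "(\<lambda>n. (1 - r) * (r ^ n * (1 / (real (Suc n))\<^sup>2 *
      (real n * h * r + real n * (real n - 1) * h\<^sup>2))) / r\<^sup>2)
      sums expectation (\<lambda>\<omega>. (hazard_est X j k \<omega>)\<^sup>2)"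
    unfolding total by simp
  from sums_unique2[OF this sums_second_moment[OF r01]]
  show "expectation (\<lambda>\<omega>. (hazard_est X j k \<omega>)\<^sup>2)
      = h\<^sup>2 / r\<^sup>2 - (1 - r) * (h * r - 3 * h\<^sup>2) / r ^ 3 * ln (1 - r)
      + (1 - r) * (2 * h\<^sup>2 - h * r) / r ^ 3 * Li2 r" .
qed

section \<open>Hazard rates as probabilities of one observation\<close>

lemma prob_at_eq: "prob_at M X i = law {i}"
  by (simp only: prob_at_def singleton_iff)

lemma survival_eq: "survival M X (int j - 1) = law {j..}"
  unfolding survival_def by (intro arg_cong[of _ _ prob]) auto

lemma sum_prob_at: "(\<Sum>i=1..k. prob_at M X (j + i)) = law {j<..j + k}"
proof (induction k)
  case (Suc k)
  have "{j<..j + Suc k} = {j<..j + k} \<union> {j + Suc k}" by auto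
  then have "law {j<..j + Suc k} = law {j<..j + k} + law {j + Suc k}"
    by (simp only:) (rule law_Un, auto)
  with Suc show ?case by (simp only: prob_at_eq sum.cl_ivl_Suc) simp
qed simp

text \<open>Infinite support puts an atom beyond every \<open>b\<close>, which makes the first
  exceedance almost surely finite.\<close>

lemma law_greaterThan_pos:
  assumes "infinite {i. prob_at M X i > 0}"
  shows "law {b<..} > 0"
proof -
  obtain i where "i > b" "prob_at M X i > 0"
    using assms unfolding infinite_nat_iff_unbounded by blast
  note \<open>prob_at M X i > 0\<close>
  also have "prob_at M X i \<le> law {b<..}"
    unfolding prob_at_eq using \<open>i > b\<close> by (intro finite_measure_mono event_X1) auto
  finally show ?thesis .
qed

end

theorem proposition3p8:
  fixes M :: "'a measure" and X :: "nat \<Rightarrow> 'a \<Rightarrow> nat"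
    and j k :: nat and h d :: real
  assumes prob: "prob_space M"
    and indep: "prob_space.indep_vars M (\<lambda>_. count_space UNIV) X {1..}"
    and ident: "\<forall>i\<ge>1. distr M (count_space UNIV) (X i) = distr M (count_space UNIV) (X 1)"
    and supp: "infinite {i. prob_at M X i > 0}"
    and k: "k \<ge> 1"
    and h: "h = hazard M X j"
    and d: "d = d_coeff M X j k"
    and pos: "1 + h - d > 0"
  shows
    "integrable M (hazard_est X j k)
     \<and> integrable M (\<lambda>\<omega>. (hazard_est X j k \<omega>)\<^sup>2)
     \<and> prob_space.expectation M (hazard_est X j k)
         = (d - h) * h / (1 + h - d) ^ 2 * ln (d - h) + h / (1 + h - d)
     \<and> prob_space.variance M (hazard_est X j k)
         = (d - h) * (h + d - 1) * h / (1 + h - d) ^ 3 * Li2 (1 + h - d)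
           - (d - h) ^ 2 * h ^ 2 / (1 + h - d) ^ 4 * (ln (d - h)) ^ 2
           - (d - h) * (1 - d) * h / (1 + h - d) ^ 3 * ln (d - h)
     \<and> prob_space.expectation M (\<lambda>\<omega>. (hazard_est X j k \<omega> - h) ^ 2)
         = (d - h) * (h + d - 1) * h / (1 + h - d) ^ 3 * Li2 (1 + h - d)
           + h ^ 2 * (d - h) ^ 2 / (1 + h - d) ^ 2
           + (d - h) * (2 * h * (d - h) - (1 - d)) * h / (1 + h - d) ^ 3 * ln (d - h)"
proof -
  interpret iid_nat M X
    by (intro iid_nat.intro iid_nat_axioms.intro) (use prob indep ident in blast)+
  \<comment> \<open>All identities are proved in \<open>h\<close> and \<open>r\<close>;
    \<open>d\<close> is restored only at the end.\<close>
  define r where "r = 1 + h - d"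
  have d_eq: "d = 1 + h - r" by (simp add: r_def)
  have h_law: "h = law {j} / law {j..}"
    by (simp add: h hazard_def prob_at_eq survival_eq)
  have "d = 1 - law {j<..j + k} / law {j..}"
    by (simp only: d d_coeff_def cond_hazard_def survival_eq sum_prob_at sum_divide_distrib[symmetric])
  moreover have "law {j..j + k} = law {j} + law {j<..j + k}"
  proof -
    have "{j..j + k} = {j} \<union> {j<..j + k}" by auto
    then show ?thesis by (simp only:) (rule law_Un, auto)
  qed
  ultimately have r_law: "r = law {j..j + k} / law {j..}"
    by (simp add: r_def h_law add_divide_distrib)
  have r: "r > 0" using pos by (simp add: r_def)
  \<comment> \<open>A positive quotient of nonnegative probabilities has a positive
    numerator.\<close>
  then have r_pos: "law {j..j + k} > 0"
    unfolding r_law by (simp add: zero_less_divide_iff)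
  note q = law_greaterThan_pos[OF supp, of "j + k"]
  have "- {..j + k} = {j + k<..}" by auto
  then have lt: "law {..j + k} < 1" using q law_compl[of "{..j + k}"] by simp
  note int1 = integrable_hazard_est_power[OF lt, of 1, simplified]
  note int2 = integrable_hazard_est_power[OF lt, of 2]
  note E1 = hazard_est_moments(1)[OF q r_pos h_law r_law]
  note E2 = hazard_est_moments(2)[OF q r_pos h_law r_law]
  have "variance (hazard_est X j k)
      = expectation (\<lambda>\<omega>. (hazard_est X j k \<omega>)\<^sup>2) - (expectation (hazard_est X j k))\<^sup>2"
    using int1 int2 by (rule variance_eq)
  \<comment> \<open>The terms \<open>h\<^sup>2 / r\<^sup>2\<close> cancel, and the cross term of the
    squared mean turns \<open>h * r - 3 * h\<^sup>2\<close> into \<open>h * (r - h)\<close>.\<close>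
  also have "\<dots> = (1 - r) * (2 * h - r) * h / r ^ 3 * Li2 r
      - (1 - r) ^ 2 * h ^ 2 / r ^ 4 * (ln (1 - r)) ^ 2
      - (1 - r) * (r - h) * h / r ^ 3 * ln (1 - r)"
    unfolding E1 E2 using r by (simp add: field_simps power2_eq_square power3_eq_cube power4_eq_xxxx)
  finally have var: "variance (hazard_est X j k) = \<dots>" .
  have "expectation (\<lambda>\<omega>. (hazard_est X j k \<omega> - h) ^ 2)
      = expectation (\<lambda>\<omega>. (hazard_est X j k \<omega>)\<^sup>2 - 2 * h * hazard_est X j k \<omega> + h\<^sup>2)"
    by (intro Bochner_Integration.integral_cong) (auto simp: power2_eq_square algebra_simps)
  also have "\<dots> = expectation (\<lambda>\<omega>. (hazard_est X j k \<omega>)\<^sup>2) - 2 * h * expectation (hazard_est X j k) + h\<^sup>2"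
    using int1 int2 by (simp add: prob_space)
  \<comment> \<open>The constants combine to a square: \<open>h\<^sup>2 / r\<^sup>2 - 2 * h\<^sup>2
    / r + h\<^sup>2 = h\<^sup>2 * (1 - r)\<^sup>2 / r\<^sup>2\<close>.\<close>
  also have "\<dots> = (1 - r) * (2 * h - r) * h / r ^ 3 * Li2 r
      + h ^ 2 * (1 - r) ^ 2 / r ^ 2
      + (1 - r) * (2 * h * (1 - r) - (r - h)) * h / r ^ 3 * ln (1 - r)"
    unfolding E1 E2 using r by (simp add: field_simps power2_eq_square power3_eq_cube)
  finally have mse: "expectation (\<lambda>\<omega>. (hazard_est X j k \<omega> - h) ^ 2) = \<dots>" .
  have "d - h = 1 - r" "h + d - 1 = 2 * h - r" "1 - d = r - h" "1 + h - d = r"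
    by (simp_all add: d_eq)
  then show ?thesis
    using int1 int2 E1 var mse by (simp only: simp_thms)
qed

end
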